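(* (i) The magma $\Gamma=M-(xM\cup\{x\})$ has the following set as a free generating set: $$\Omega=\{s_1\cdot s_2:\ s_1\in M-\{x\},\ s_2\in M,\ \text{s.t. } s_1\notin\Gamma\text{ or }s_2\notin\Gamma\}$$ $$=\{(x^i.v_1)\cdot(x^j.v_2):\ v_1,v_2\in\Gamma\cup\{1\},\ i+j\geq 1,\ v_1\neq 1\text{ if }i\leq 1,\ v_2\neq 1\text{ if }j=0\}.$$ (ii) Let $\Omega_n=\{\omega\in\Omega:\deg(\omega)=n\}$. Then $\Omega_1=\Omega_2=\emptyset$, $\Omega_3=\{x^2x\}$, and for $n\geq 4$, $\#\Omega_n=3(c_{n-1}-c_{n-2})$.
   Context: $M=M(x)$ is the free magma (without unit) on one generator $x$, i.e. planar binary rooted trees; $\deg$ is the number of leaves; $xM=\{x\cdot t: t\in M\}$; $\Gamma$ is a sub-magma of $M$. $1$ denotes the empty tree, a neutral element adjoined to $M$. For $v\in M\cup\{1\}$ and an integer $i\geq 0$, $x^i.v=L^i(v)$ where $L(v)=x\cdot v$ (so $L(1)=x$), and $x^i=L^i(1)$; thus $x^2x=(x\cdot x)\cdot x$. $c_n=\frac{(2(n-1))!}{n!(n-1)!}$ for $n\geq 1$ are the Catalan numbers. *)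

theory Defs
  imports Complex_Main
begin

text \<open>The free magma (without unit) on a set of generators: planar binary rooted trees whose
  leaves are labelled by generators.\<close>

datatype (gens: 'a) free_magma =
    Gen 'a
  | Mult "'a free_magma" "'a free_magma" (infixl "\<cdot>" 70)

primrec deg :: "'a free_magma \<Rightarrow> nat" where
  "deg (Gen a) = 1"
| "deg (s \<cdot> t) = deg s + deg t"

text \<open>The homomorphism from the free magma to a magma with product \<open>f\<close> that is induced by the
  inclusion of the generators.\<close>

primrec eval_magma :: "('a \<Rightarrow> 'a \<Rightarrow> 'a) \<Rightarrow> 'a free_magma \<Rightarrow> 'a" where
  "eval_magma f (Gen a) = a"
| "eval_magma f (s \<cdot> t) = f (eval_magma f s) (eval_magma f t)"

definition submagma :: "('a \<Rightarrow> 'a \<Rightarrow> 'a) \<Rightarrow> 'a set \<Rightarrow> bool" where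
  "submagma f C \<longleftrightarrow> (\<forall>a\<in>C. \<forall>b\<in>C. f a b \<in> C)"

text \<open>\<open>S\<close> is a free generating set of the magma \<open>C\<close>: the induced homomorphism from the free magma
  over \<open>S\<close> to \<open>C\<close> is an isomorphism. Unlike the universal property, which is derived below for
  target magmas of an arbitrary type, this does not involve a quantification over types.\<close>

definition free_generating_set :: "('a \<Rightarrow> 'a \<Rightarrow> 'a) \<Rightarrow> 'a set \<Rightarrow> 'a set \<Rightarrow> bool" where
  "free_generating_set f C S \<longleftrightarrow>
     submagma f C \<and> S \<subseteq> C \<and> bij_betw (eval_magma f) {t. gens t \<subseteq> S} C"

primrec extend_magma :: "('b \<Rightarrow> 'b \<Rightarrow> 'b) \<Rightarrow> ('a \<Rightarrow> 'b) \<Rightarrow> 'a free_magma \<Rightarrow> 'b" where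
  "extend_magma g \<phi> (Gen a) = \<phi> a"
| "extend_magma g \<phi> (s \<cdot> t) = g (extend_magma g \<phi> s) (extend_magma g \<phi> t)"

lemma free_generating_set_universal:
  fixes f :: "'a \<Rightarrow> 'a \<Rightarrow> 'a" and g :: "'b \<Rightarrow> 'b \<Rightarrow> 'b"
  assumes free: "free_generating_set f C S"
    and D: "submagma g D" and \<phi>: "\<phi> ` S \<subseteq> D"
  shows "\<exists>h. (h ` C \<subseteq> D \<and> (\<forall>a\<in>C. \<forall>b\<in>C. h (f a b) = g (h a) (h b)) \<and> (\<forall>s\<in>S. h s = \<phi> s)) \<and>
    (\<forall>k. (\<forall>a\<in>C. \<forall>b\<in>C. k (f a b) = g (k a) (k b)) \<and> (\<forall>s\<in>S. k s = \<phi> s) \<longrightarrow> (\<forall>a\<in>C. k a = h a))"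
proof -
  let ?T = "{t. gens t \<subseteq> S}"
  have C: "\<And>a b. a \<in> C \<Longrightarrow> b \<in> C \<Longrightarrow> f a b \<in> C" and SC: "S \<subseteq> C"
    and bij: "bij_betw (eval_magma f) ?T C"
    using free by (auto simp: free_generating_set_def submagma_def)
  define e where "e = inv_into ?T (eval_magma f)"
  have eC: "gens (e a) \<subseteq> S" and ee: "eval_magma f (e a) = a" if "a \<in> C" for a
    using bij that inv_into_into[of a "eval_magma f" ?T]
    by (auto simp: e_def bij_betw_def f_inv_into_f)
  have eT: "e (eval_magma f t) = t" if "gens t \<subseteq> S" for t
    using bij that by (simp add: e_def bij_betw_def)
  have e_mult: "e (f a b) = e a \<cdot> e b" if "a \<in> C" "b \<in> C" for a b
    using eT[of "e a \<cdot> e b"] eC[OF that(1)] eC[OF that(2)] ee[OF that(1)] ee[OF that(2)] by simp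
  have e_gen: "e s = Gen s" if "s \<in> S" for s
    using eT[of "Gen s"] that by simp
  define h where "h = (\<lambda>a. extend_magma g \<phi> (e a))"
  have inD: "gens t \<subseteq> S \<Longrightarrow> extend_magma g \<phi> t \<in> D" for t
    using D \<phi> by (induction t) (auto simp: submagma_def)
  have evC: "gens t \<subseteq> S \<Longrightarrow> eval_magma f t \<in> C" for t
    using bij by (auto simp: bij_betw_def)
  have uniq: "k a = h a"
    if k: "\<forall>a\<in>C. \<forall>b\<in>C. k (f a b) = g (k a) (k b)" "\<forall>s\<in>S. k s = \<phi> s" and a: "a \<in> C" for k a
  proof -
    have "gens t \<subseteq> S \<Longrightarrow> k (eval_magma f t) = extend_magma g \<phi> t" for t
      using k evC by (induction t) auto
    from this[OF eC[OF a]] show ?thesis using ee[OF a] by (simp add: h_def)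
  qed
  show ?thesis
  proof (intro exI[of _ h] conjI)
    show "h ` C \<subseteq> D" using inD eC by (auto simp: h_def)
  qed (use uniq e_mult e_gen in \<open>auto simp: h_def\<close>)
qed

text \<open>The free magma \<open>M\<close> on one generator is the universe of the following type.\<close>

type_synonym M = "unit free_magma"

abbreviation x :: M where
  "x \<equiv> Gen ()"

text \<open>\<open>M \<union> {1}\<close> is rendered as \<^typ>\<open>M option\<close>, where \<^const>\<open>None\<close> is the empty tree \<open>1\<close>.\<close>

fun mult1 :: "M option \<Rightarrow> M option \<Rightarrow> M option" (infixl "\<odot>" 70) where
  "None \<odot> v = v"
| "u \<odot> None = u"
| "Some s \<odot> Some t = Some (s \<cdot> t)"

definition xpow :: "nat \<Rightarrow> M option \<Rightarrow> M option" where
  "xpow i v = ((\<lambda>w. Some x \<odot> w) ^^ i) v"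

definition Gam :: "M set" where
  "Gam = UNIV - ({x \<cdot> t | t. True} \<union> {x})"

definition Omega :: "M set" where
  "Omega = {s1 \<cdot> s2 | s1 s2. s1 \<in> UNIV - {x} \<and> (s1 \<notin> Gam \<or> s2 \<notin> Gam)}"

definition Omega_deg :: "nat \<Rightarrow> M set" where
  "Omega_deg n = {w \<in> Omega. deg w = n}"

text \<open>Only meant for \<open>n \<ge> 1\<close>.\<close>

definition catalan :: "nat \<Rightarrow> real" where
  "catalan n = fact (2 * (n - 1)) / (fact n * fact (n - 1))"

end

theory Submission
  imports Defs "HOL-Computational_Algebra.Formal_Power_Series"
begin

text \<open>
  A factorisation of an element of a free magma into a product is unique, so in every submagma
  \<open>C\<close> each element is either indecomposable in \<open>C\<close> or a product of a unique pair of smaller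
  elements of \<open>C\<close>. Hence \<open>C\<close> is free on its indecomposables, and \<^const>\<open>Omega\<close> is the set of
  indecomposables of \<^const>\<open>Gam\<close> (\<open>submagma_free_on_indecomposables\<close>,
  \<open>Omega_eq_indecomposables\<close>). The second description of \<^const>\<open>Omega\<close> comes from peeling off
  left factors \<open>x\<close> as long as possible: every tree is \<open>x\<^sup>i.v\<close> with \<open>v \<in> \<Gamma> \<union> {1}\<close>, and it lies
  in \<open>\<Gamma>\<close> exactly if \<open>i = 0\<close> (\<open>exists_xpow\<close>, \<open>xpow_eq_Some\<close>).

  For the count, let \<open>T\<^sub>n\<close> be the number of trees of degree \<open>n\<close>. The rotation
  \<open>a \<cdot> b \<mapsto> (x \<cdot> a) \<cdot> b\<close> shows that, for \<open>n \<ge> 3\<close>, there are \<open>T\<^sub>n\<^sub>-\<^sub>1\<close> trees of degree \<open>n\<close> whose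
  left factor lies in \<open>xM\<close>. For \<open>n \<ge> 4\<close>, an element of \<open>\<Omega>\<^sub>n\<close> has exactly one of the shapes
  \<^item> \<open>(x \<cdot> a) \<cdot> b\<close>: there are \<open>T\<^sub>n\<^sub>-\<^sub>1\<close> of them, by rotation;
  \<^item> \<open>s \<cdot> x\<close> with \<open>s \<in> \<Gamma>\<close>: there are \<open>T\<^sub>n\<^sub>-\<^sub>1 - T\<^sub>n\<^sub>-\<^sub>2\<close> of them;
  \<^item> \<open>s \<cdot> (x \<cdot> t)\<close> with \<open>s \<in> \<Gamma>\<close>: these correspond to the trees \<open>s \<cdot> t\<close> of degree \<open>n - 1\<close> with
    \<open>s \<in> \<Gamma>\<close>, that is, to all trees of degree \<open>n - 1\<close> except the \<open>T\<^sub>n\<^sub>-\<^sub>2\<close> trees \<open>x \<cdot> t\<close> and the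
    \<open>T\<^sub>n\<^sub>-\<^sub>2\<close> trees \<open>(x \<cdot> u) \<cdot> t\<close>.

  The sum is \<open>3 (T\<^sub>n\<^sub>-\<^sub>1 - T\<^sub>n\<^sub>-\<^sub>2)\<close>. Finally \<open>T\<^sub>n\<close> is the Catalan number \<open>c\<^sub>n\<close>: splitting a tree at
  its root gives \<open>c = X + c\<^sup>2\<close> for the generating function, and differentiating this
  turns the convolution into a recurrence of order one (\<open>card_trees_eq_catalan\<close>).
\<close>

section \<open>Freeness of submagmas of a free magma\<close>

text \<open>Injectivity of the evaluation holds since an indecomposable is never the value of a proper
  product, and two equal products in a free magma have equal factors. Surjectivity is an induction
  on trees: an element that is not indecomposable has both factors in \<open>C\<close>.\<close>

lemma submagma_free_on_indecomposables:
  fixes C :: "'a free_magma set"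
  assumes C: "submagma (\<cdot>) C"
  shows "free_generating_set (\<cdot>) C (C - {s \<cdot> t | s t. s \<in> C \<and> t \<in> C})"
proof -
  let ?S = "C - {s \<cdot> t | s t. s \<in> C \<and> t \<in> C}"
  let ?e = "eval_magma (\<cdot>) :: 'a free_magma free_magma \<Rightarrow> 'a free_magma"
  have in_C: "?e t \<in> C" if "gens t \<subseteq> ?S" for t
    using that C by (induction t) (auto simp: submagma_def)
  have inj: "t = u" if "gens t \<subseteq> ?S" "gens u \<subseteq> ?S" "?e t = ?e u" for t u
    using that
  proof (induction t arbitrary: u)
    case (Gen a)
    then have a: "a \<in> ?S" by simp
    show ?case
    proof (cases u)
      case (Mult u1 u2)
      then have "?e u1 \<in> C" "?e u2 \<in> C" "a = ?e u1 \<cdot> ?e u2"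
        using Gen in_C[of u1] in_C[of u2] by auto
      then show ?thesis using a by blast
    qed (use Gen in simp)
  next
    case (Mult t1 t2)
    then have t: "?e t1 \<in> C" "?e t2 \<in> C"
      using in_C[of t1] in_C[of t2] by auto
    show ?case
    proof (cases u)
      case (Gen b)
      then have "b \<in> ?S" "b = ?e t1 \<cdot> ?e t2" using Mult by auto
      then show ?thesis using t by blast
    next
      case (Mult u1 u2)
      then show ?thesis using Mult.IH[of u1] Mult.IH[of u2] Mult.prems by auto
    qed
  qed
  have surj: "\<exists>t. gens t \<subseteq> ?S \<and> ?e t = c" if "c \<in> C" for c
    using that
  proof (induction c)
    case (Gen a)
    then show ?case by (intro exI[of _ "Gen (Gen a)"]) auto
  next
    case (Mult s t)
    show ?case
    proof (cases "s \<in> C \<and> t \<in> C")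
      case True
      with Mult obtain s' t' where "gens s' \<subseteq> ?S" "?e s' = s" "gens t' \<subseteq> ?S" "?e t' = t"
        by blast
      then show ?thesis by (intro exI[of _ "s' \<cdot> t'"]) auto
    next
      case False
      then show ?thesis using Mult.prems by (intro exI[of _ "Gen (s \<cdot> t)"]) auto
    qed
  qed
  have "bij_betw ?e {t. gens t \<subseteq> ?S} C"
    unfolding bij_betw_def
  proof
    show "inj_on ?e {t. gens t \<subseteq> ?S}" using inj by (auto intro!: inj_onI)
    show "?e ` {t. gens t \<subseteq> ?S} = C" using in_C surj by (force simp: image_iff)
  qed
  then show ?thesis using C by (auto simp: free_generating_set_def)
qed

section \<open>The magma \<open>\<Gamma>\<close> and its indecomposables\<close>

lemma Gen_notin_Gam [simp]: "Gen u \<notin> Gam"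
  by (simp add: Gam_def)

lemma Mult_in_Gam_iff [simp]: "s \<cdot> t \<in> Gam \<longleftrightarrow> s \<noteq> x"
  by (auto simp: Gam_def)

lemma submagma_Gam: "submagma (\<cdot>) Gam"
  by (auto simp: submagma_def)

text \<open>The condition \<open>s1 \<noteq> x\<close> in the definition of \<^const>\<open>Omega\<close> says that the product is in
  \<^const>\<open>Gam\<close>, and the other condition that this factorisation, the only one, is not inside
  \<^const>\<open>Gam\<close>.\<close>

lemma Omega_eq_indecomposables: "Omega = Gam - {s \<cdot> t | s t. s \<in> Gam \<and> t \<in> Gam}"
proof (rule set_eqI)
  fix w
  show "w \<in> Omega \<longleftrightarrow> w \<in> Gam - {s \<cdot> t | s t. s \<in> Gam \<and> t \<in> Gam}"
    by (cases w) (auto simp: Omega_def)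
qed

lemma notin_Gam_iff: "s \<notin> Gam \<longleftrightarrow> s = x \<or> (\<exists>t. s = x \<cdot> t)"
  by (cases s) auto

section \<open>Peeling off left factors \<open>x\<close>\<close>

lemma xpow_0 [simp]: "xpow 0 v = v"
  by (simp add: xpow_def)

lemma xpow_Suc [simp]: "xpow (Suc i) v = Some x \<odot> xpow i v"
  by (simp add: xpow_def)

lemma exists_xpow:
  "\<exists>i v. v \<in> Some ` Gam \<union> {None} \<and> (i = 0 \<longrightarrow> v \<noteq> None) \<and> Some s = xpow i v"
proof (induction s)
  case (Gen u)
  show ?case by (intro exI[of _ 1] exI[of _ None]) simp
next
  case (Mult s t)
  show ?case
  proof (cases "s = x")
    case True
    from Mult.IH(2) obtain i v where v: "v \<in> Some ` Gam \<union> {None}" and t: "Some t = xpow i v"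
      by blast
    show ?thesis
      by (intro exI[of _ "Suc i"] exI[of _ v]) (use v True in \<open>simp add: t[symmetric]\<close>)
  next
    case False
    then show ?thesis by (intro exI[of _ 0] exI[of _ "Some (s \<cdot> t)"]) auto
  qed
qed

text \<open>The exponent can be recognised in the tree \<open>x\<^sup>i.v\<close> as far as the description of \<open>\<Omega>\<close> needs:
  whether the tree lies in \<open>\<Gamma>\<close>, and whether it is \<open>x\<close>.\<close>

lemma xpow_eq_Some:
  assumes "v \<in> Some ` Gam \<union> {None}" and "i = 0 \<longrightarrow> v \<noteq> None"
  shows "\<exists>s. xpow i v = Some s \<and> (s \<in> Gam \<longleftrightarrow> i = 0) \<and> (s = x \<longleftrightarrow> i = 1 \<and> v = None)"
proof (cases i)
  case 0
  then obtain s where s: "v = Some s" "s \<in> Gam" using assms by auto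
  then have "s \<noteq> x" by (metis Gen_notin_Gam)
  then show ?thesis using 0 s by simp
next
  case (Suc k)
  show ?thesis
  proof (cases "xpow k v")
    case None
    then have "k = 0 \<and> v = None" by (cases k; cases "xpow (k - 1) v") auto
    then show ?thesis using Suc by auto
  next
    case (Some t)
    then have "\<not> (k = 0 \<and> v = None)" by auto
    then show ?thesis using Suc Some by auto
  qed
qed

lemma Omega_eq_xpow_products:
  "Some ` Omega =
     {xpow i v1 \<odot> xpow j v2 | i j v1 v2.
        v1 \<in> Some ` Gam \<union> {None} \<and> v2 \<in> Some ` Gam \<union> {None} \<and> i + j \<ge> 1 \<and>
        (i \<le> 1 \<longrightarrow> v1 \<noteq> None) \<and> (j = 0 \<longrightarrow> v2 \<noteq> None)}"
    (is "_ = ?R")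
proof
  show "Some ` Omega \<subseteq> ?R"
  proof
    fix w assume "w \<in> Some ` Omega"
    then obtain s1 s2 where w: "w = Some (s1 \<cdot> s2)" and s: "s1 \<noteq> x" "s1 \<notin> Gam \<or> s2 \<notin> Gam"
      by (auto simp: Omega_def)
    obtain i v1 where v1: "v1 \<in> Some ` Gam \<union> {None}" "i = 0 \<longrightarrow> v1 \<noteq> None" "Some s1 = xpow i v1"
      using exists_xpow[of s1] by metis
    obtain j v2 where v2: "v2 \<in> Some ` Gam \<union> {None}" "j = 0 \<longrightarrow> v2 \<noteq> None" "Some s2 = xpow j v2"
      using exists_xpow[of s2] by metis
    have i: "s1 \<in> Gam \<longleftrightarrow> i = 0" "s1 = x \<longleftrightarrow> i = 1 \<and> v1 = None"
      using xpow_eq_Some[OF v1(1,2)] unfolding v1(3)[symmetric] by simp_all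
    have j: "s2 \<in> Gam \<longleftrightarrow> j = 0"
      using xpow_eq_Some[OF v2(1,2)] unfolding v2(3)[symmetric] by simp
    have "w = xpow i v1 \<odot> xpow j v2"
      by (simp add: w v1(3)[symmetric] v2(3)[symmetric])
    moreover have "i + j \<ge> 1" using s i j by auto
    moreover have "i \<le> 1 \<longrightarrow> v1 \<noteq> None"
      using s(1) i(2) v1(2) by (auto simp: le_Suc_eq)
    ultimately show "w \<in> ?R" using v1(1) v2(1,2) by blast
  qed
next
  show "?R \<subseteq> Some ` Omega"
  proof
    fix w assume "w \<in> ?R"
    then obtain i j v1 v2 where w: "w = xpow i v1 \<odot> xpow j v2"
      and v: "v1 \<in> Some ` Gam \<union> {None}" "v2 \<in> Some ` Gam \<union> {None}"
      and ij: "i + j \<ge> 1" "i \<le> 1 \<longrightarrow> v1 \<noteq> None" "j = 0 \<longrightarrow> v2 \<noteq> None"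
      by blast
    have i0: "i = 0 \<longrightarrow> v1 \<noteq> None" using ij(2) by simp
    obtain s1 where s1: "xpow i v1 = Some s1" "s1 \<in> Gam \<longleftrightarrow> i = 0" "s1 = x \<longleftrightarrow> i = 1 \<and> v1 = None"
      using xpow_eq_Some[OF v(1) i0] by (elim exE conjE) (rule that)
    obtain s2 where s2: "xpow j v2 = Some s2" "s2 \<in> Gam \<longleftrightarrow> j = 0"
      using xpow_eq_Some[OF v(2) ij(3)] by (elim exE conjE) (rule that)
    have "s1 \<noteq> x" "s1 \<notin> Gam \<or> s2 \<notin> Gam" using s1 s2 ij by auto
    then have "s1 \<cdot> s2 \<in> Omega" by (auto simp: Omega_def)
    then show "w \<in> Some ` Omega" by (simp add: w s1(1) s2(1))
  qed
qed

section \<open>The number of trees of given degree\<close>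

definition trees :: "nat \<Rightarrow> M set" where
  "trees n = {t. deg t = n}"

lemma deg_pos [simp]: "deg t > 0"
  by (induction t) auto

lemma deg_neq_0 [simp]: "deg t \<noteq> 0"
  using deg_pos[of t] by linarith

lemma trees_0: "trees 0 = {}"
  by (simp add: trees_def)

lemma trees_1: "trees (Suc 0) = {x}"
proof -
  have "deg t = Suc 0 \<longleftrightarrow> t = x" for t :: M
    by (cases t) (auto simp: add_is_1)
  then show ?thesis by (simp add: trees_def)
qed

lemma trees_split:
  assumes "n \<ge> 2"
  shows "trees n = (\<lambda>(s, t). s \<cdot> t) ` (\<Union>i\<in>{..n}. trees i \<times> trees (n - i))"
proof (rule set_eqI)
  fix t
  show "t \<in> trees n \<longleftrightarrow> t \<in> (\<lambda>(s, t). s \<cdot> t) ` (\<Union>i\<in>{..n}. trees i \<times> trees (n - i))"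
    using assms by (cases t) (auto simp: trees_def image_iff)
qed

lemma finite_trees [simp]: "finite (trees n)"
proof (induction n rule: less_induct)
  case (less n)
  consider "n = 0" | "n = Suc 0" | "n \<ge> 2" by linarith
  then show ?case
  proof cases
    case 3
    have "finite (trees i \<times> trees (n - i))" if "i \<le> n" for i
      \<comment> \<open>For \<open>i = 0\<close> and \<open>i = n\<close> one factor has degree \<open>n\<close>, but the other one is empty.\<close>
      using less that by (cases "i = 0 \<or> i = n") (auto simp: trees_0)
    then show ?thesis using 3 by (simp add: trees_split)
  qed (simp_all add: trees_0 trees_1)
qed

lemma card_trees_convolution:
  assumes "n \<ge> 2"
  shows "card (trees n) = (\<Sum>i\<le>n. card (trees i) * card (trees (n - i)))"
proof -
  let ?P = "\<lambda>i. trees i \<times> trees (n - i)"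
  have "card (trees n) = card (\<Union>i\<in>{..n}. ?P i)"
    unfolding trees_split[OF assms] by (rule card_image) (auto intro!: inj_onI)
  also have "\<dots> = (\<Sum>i\<le>n. card (?P i))"
  proof (rule card_UN_disjoint)
    show "\<forall>i\<in>{..n}. \<forall>j\<in>{..n}. i \<noteq> j \<longrightarrow> ?P i \<inter> ?P j = {}"
      by (auto simp: trees_def)
  qed simp_all
  finally show ?thesis by (simp add: card_cartesian_product)
qed

text \<open>From \<open>c = X + c\<^sup>2\<close> one gets \<open>c' (1 - 2 c) = 1\<close> and \<open>(1 - 2 c)\<^sup>2 = 1 - 4 X\<close>, and therefore
  the linear differential equation \<open>c' (1 - 4 X) = 1 - 2 c\<close>, whose coefficients give the
  recurrence.\<close>

lemma card_trees_recurrence: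
  assumes "n \<ge> 1"
  shows "real (n + 1) * real (card (trees (n + 1))) = (4 * real n - 2) * real (card (trees n))"
proof -
  define c :: "real fps" where "c = Abs_fps (\<lambda>n. real (card (trees n)))"
  have c_nth: "fps_nth c n = real (card (trees n))" for n
    by (simp add: c_def)
  have c: "c = fps_X + c * c"
  proof (rule fps_ext)
    fix n
    consider "n = 0" | "n = Suc 0" | "n \<ge> 2" by linarith
    then show "fps_nth c n = fps_nth (fps_X + c * c) n"
    proof cases
      case 3
      then show ?thesis
        by (simp add: c_nth fps_mult_nth card_trees_convolution[OF 3] fps_X_def atLeast0AtMost)
    qed (simp_all add: c_nth fps_mult_nth trees_0 trees_1)
  qed
  have "fps_deriv c = 1 + 2 * (c * fps_deriv c)"
    using arg_cong[OF c, of fps_deriv] by (simp add: algebra_simps)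
  then have d: "fps_deriv c * (1 - 2 * c) = 1"
    by (simp add: algebra_simps)
  have "(1 - 2 * c) * (1 - 2 * c) = 1 - 4 * c + 4 * (c * c)"
    by (simp add: algebra_simps)
  also have "\<dots> = 1 - 4 * (c - c * c)"
    by (simp add: algebra_simps)
  also have "c - c * c = fps_X"
    using c by (simp add: algebra_simps)
  finally have "fps_deriv c * (1 - 2 * c) * (1 - 2 * c) = fps_deriv c * (1 - 4 * fps_X)"
    by (simp add: mult.assoc)
  then have ode: "1 - 2 * c = fps_deriv c - 4 * (fps_X * fps_deriv c)"
    unfolding d by (simp add: algebra_simps)
  obtain k where k: "n = Suc k" using assms by (cases n) auto
  \<comment> \<open>Coefficients of a scalar multiple are simplified once the scalar is a constant series.\<close>
  have num: "2 * c = fps_const 2 * c"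
    "4 * (fps_X * fps_deriv c) = fps_const 4 * (fps_X * fps_deriv c)"
    by (simp_all add: numeral_fps_const)
  have "fps_nth (1 - fps_const 2 * c) n = fps_nth (fps_deriv c - fps_const 4 * (fps_X * fps_deriv c)) n"
    using ode unfolding num by simp
  then show ?thesis
    by (simp add: k c_nth algebra_simps)
qed

lemma card_trees_eq_catalan:
  assumes "n \<ge> 1"
  shows "real (card (trees n)) = catalan n"
  using assms
proof (induction n rule: dec_induct)
  case base
  show ?case by (simp add: trees_1 catalan_def)
next
  case (step n)
  obtain k where k: "n = Suc k" using step by (cases n) auto
  have "real (n + 1) * catalan (n + 1) = (4 * real n - 2) * catalan n"
    by (simp add: catalan_def k divide_simps) (simp add: algebra_simps)
  also have "\<dots> = real (n + 1) * real (card (trees (n + 1)))"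
    using card_trees_recurrence[OF step.hyps(1)] step.IH by simp
  finally show ?case by simp
qed

section \<open>Counting indecomposables\<close>

lemma card_x_mult_trees: "card ((\<cdot>) x ` trees n) = card (trees n)"
  by (rule card_image) (auto intro!: inj_onI)

primrec rotate_in :: "M \<Rightarrow> M" where
  "rotate_in (Gen u) = Gen u"
| "rotate_in (a \<cdot> b) = (x \<cdot> a) \<cdot> b"

lemma rotate_in_image:
  assumes "n \<ge> 2"
  shows "rotate_in ` trees n = {(x \<cdot> a) \<cdot> b | a b. deg a + deg b = n}"
proof (rule set_eqI)
  fix t
  have "t \<in> rotate_in ` trees n \<longleftrightarrow> (\<exists>s. deg s = n \<and> t = rotate_in s)"
    by (auto simp: trees_def)
  also have "\<dots> \<longleftrightarrow> (\<exists>a b. deg (a \<cdot> b) = n \<and> t = rotate_in (a \<cdot> b))"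
  proof -
    have "\<exists>a b. s = a \<cdot> b" if "deg s = n" for s :: M
      using that assms by (cases s) auto
    then show ?thesis by blast
  qed
  finally show "t \<in> rotate_in ` trees n \<longleftrightarrow> t \<in> {(x \<cdot> a) \<cdot> b | a b. deg a + deg b = n}"
    by auto
qed

text \<open>The bound on \<open>n\<close> excludes the tree \<open>x\<close>, the only one that is not a product and thus cannot
  be rotated.\<close>

lemma card_rotated:
  assumes "n \<ge> 2"
  shows "card {(x \<cdot> a) \<cdot> b | a b. deg a + deg b = n} = card (trees n)"
proof -
  have "inj_on rotate_in (trees n)"
  proof (rule inj_onI)
    fix s t assume "s \<in> trees n" "t \<in> trees n" "rotate_in s = rotate_in t"
    then show "s = t" using assms by (cases s; cases t) (auto simp: trees_def)
  qed
  then show ?thesis using rotate_in_image[OF assms] by (metis card_image)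
qed

lemma finite_rotated [simp]:
  "finite {(x \<cdot> a) \<cdot> b | a b. deg a + deg b = n}"
  by (rule finite_subset[OF _ finite_trees[of "Suc n"]]) (auto simp: trees_def)

lemma card_Gam_trees:
  assumes "n \<ge> 1"
  shows "card (Gam \<inter> trees (Suc n)) = card (trees (Suc n)) - card (trees n)"
proof -
  have "Gam \<inter> trees (Suc n) = trees (Suc n) - (\<cdot>) x ` trees n"
  proof (rule set_eqI)
    fix t
    show "t \<in> Gam \<inter> trees (Suc n) \<longleftrightarrow> t \<in> trees (Suc n) - (\<cdot>) x ` trees n"
      using assms by (cases t) (auto simp: trees_def)
  qed
  moreover have "(\<cdot>) x ` trees n \<subseteq> trees (Suc n)"
    by (auto simp: trees_def)
  ultimately show ?thesis
    by (simp add: card_Diff_subset card_x_mult_trees)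
qed

text \<open>A left factor outside \<open>\<Gamma>\<close> is \<open>x\<close> or of the form \<open>x \<cdot> u\<close>; trees with such a left factor are
  counted by prefixing with \<open>x\<close> and by rotation, respectively, and subtracted from all trees.\<close>

lemma card_left_factor_in_Gam:
  assumes "n \<ge> 2"
  shows "card {s \<cdot> t | s t. s \<in> Gam \<and> deg s + deg t = Suc n} = card (trees (Suc n)) - 2 * card (trees n)"
proof -
  let ?X = "(\<cdot>) x ` trees n" and ?R = "{(x \<cdot> a) \<cdot> b | a b. deg a + deg b = n}"
  have "{s \<cdot> t | s t. s \<in> Gam \<and> deg s + deg t = Suc n} = trees (Suc n) - (?X \<union> ?R)" (is "?L = _")
  proof (rule set_eqI)
    fix w
    show "w \<in> ?L \<longleftrightarrow> w \<in> trees (Suc n) - (?X \<union> ?R)"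
    proof (cases w)
      case (Mult s t)
      then show ?thesis
        by (cases s) (auto simp: trees_def)
    qed (use assms in \<open>auto simp: trees_def\<close>)
  qed
  moreover have "card (?X \<union> ?R) = 2 * card (trees n)"
  proof -
    have "card (?X \<union> ?R) = card ?X + card ?R"
      by (rule card_Un_disjoint) auto
    then show ?thesis by (simp add: card_x_mult_trees card_rotated[OF assms])
  qed
  moreover have "?X \<union> ?R \<subseteq> trees (Suc n)"
    by (auto simp: trees_def)
  ultimately show ?thesis by (simp add: card_Diff_subset)
qed

primrec prefix_right :: "M \<Rightarrow> M" where
  "prefix_right (Gen u) = Gen u"
| "prefix_right (s \<cdot> t) = s \<cdot> (x \<cdot> t)"

lemma card_prefixed_right:
  "card {s \<cdot> (x \<cdot> t) | s t. s \<in> Gam \<and> deg s + deg t = n} =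
     card {s \<cdot> t | s t. s \<in> Gam \<and> deg s + deg t = n}" (is "card ?A = card ?B")
proof -
  have "?A = prefix_right ` ?B"
  proof
    show "?A \<subseteq> prefix_right ` ?B"
    proof
      fix w assume "w \<in> ?A"
      then obtain s t where "w = prefix_right (s \<cdot> t)" "s \<in> Gam" "deg s + deg t = n" by auto
      then show "w \<in> prefix_right ` ?B" by blast
    qed
  qed auto
  moreover have "inj_on prefix_right ?B"
  proof (rule inj_onI)
    fix s t assume "s \<in> ?B" "t \<in> ?B" "prefix_right s = prefix_right t"
    then show "s = t" by (cases s; cases t) auto
  qed
  ultimately show ?thesis by (simp add: card_image)
qed

lemma finite_Omega_deg: "finite (Omega_deg n)"
  by (rule finite_subset[OF _ finite_trees[of n]]) (auto simp: Omega_deg_def trees_def)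

lemma Omega_deg_decomposition:
  "Omega_deg (Suc n) =
     {(x \<cdot> a) \<cdot> b | a b. deg a + deg b = n} \<union> (\<lambda>s. s \<cdot> x) ` (Gam \<inter> trees n) \<union>
     {s \<cdot> (x \<cdot> t) | s t. s \<in> Gam \<and> deg s + deg t = n}" (is "_ = ?A \<union> ?B \<union> ?C")
proof (rule set_eqI)
  fix w
  show "w \<in> Omega_deg (Suc n) \<longleftrightarrow> w \<in> ?A \<union> ?B \<union> ?C"
  proof (cases w)
    case (Mult s t)
    have "w \<in> Omega_deg (Suc n) \<longleftrightarrow> s \<noteq> x \<and> (s \<notin> Gam \<or> t \<notin> Gam) \<and> deg s + deg t = Suc n"
      by (auto simp: Mult Omega_deg_def Omega_def)
    also have "\<dots> \<longleftrightarrow> (\<exists>a. s = x \<cdot> a \<and> deg a + deg t = n) \<or> (s \<in> Gam \<and> t = x \<and> deg s = n) \<or>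
        (\<exists>u. s \<in> Gam \<and> t = x \<cdot> u \<and> deg s + deg u = n)"
      by (cases "s \<in> Gam") (auto simp: notin_Gam_iff)
    also have "\<dots> \<longleftrightarrow> w \<in> ?A \<union> ?B \<union> ?C"
      by (auto simp: Mult trees_def)
    finally show ?thesis .
  qed (auto simp: Omega_deg_def Omega_def)
qed

lemma card_Omega_deg:
  assumes "n \<ge> 2"
  shows "real (card (Omega_deg (Suc (Suc n)))) = 3 * (real (card (trees (Suc n))) - real (card (trees n)))"
proof -
  let ?A = "{(x \<cdot> a) \<cdot> b | a b. deg a + deg b = Suc n}"
  let ?B = "(\<lambda>s. s \<cdot> x) ` (Gam \<inter> trees (Suc n))"
  let ?C = "{s \<cdot> (x \<cdot> t) | s t. s \<in> Gam \<and> deg s + deg t = Suc n}"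
  have fin: "finite ?A" "finite ?B" "finite ?C"
    using finite_Omega_deg[of "Suc (Suc n)"] by (simp_all add: Omega_deg_decomposition)
  have "card (Omega_deg (Suc (Suc n))) = card ?A + card ?B + card ?C"
    unfolding Omega_deg_decomposition
    by (subst card_Un_disjoint; (subst card_Un_disjoint)?) (use fin in auto)
  moreover have "card ?A = card (trees (Suc n))"
    using assms by (intro card_rotated) simp
  moreover have "card ?B = card (trees (Suc n)) - card (trees n)"
    using assms card_Gam_trees[of n] by (subst card_image) (auto intro!: inj_onI)
  moreover have "card ?C = card (trees (Suc n)) - 2 * card (trees n)"
    using card_left_factor_in_Gam[OF assms] by (simp add: card_prefixed_right)
  \<comment> \<open>The differences above are truncated; this makes them genuine.\<close>
  moreover have "2 * card (trees n) \<le> card (trees (Suc n))"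
  proof -
    have "card ((\<cdot>) x ` trees n \<union> {(x \<cdot> a) \<cdot> b | a b. deg a + deg b = n}) \<le> card (trees (Suc n))"
      by (rule card_mono[OF finite_trees]) (auto simp: trees_def)
    moreover have "card ((\<cdot>) x ` trees n \<union> {(x \<cdot> a) \<cdot> b | a b. deg a + deg b = n}) =
        card ((\<cdot>) x ` trees n) + card {(x \<cdot> a) \<cdot> b | a b. deg a + deg b = n}"
      by (rule card_Un_disjoint) auto
    ultimately show ?thesis by (simp add: card_x_mult_trees card_rotated[OF assms])
  qed
  ultimately show ?thesis by (simp add: of_nat_diff)
qed

lemma deg_eq_1_iff: "deg t = Suc 0 \<longleftrightarrow> t = x"
  using trees_1 by (auto simp: trees_def)

text \<open>Elements of \<open>\<Gamma>\<close> have degree at least 3. This disposes of the degrees 1 and 2, and in degree 3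
  it leaves only the shape \<open>(x \<cdot> a) \<cdot> b\<close>, with \<open>a = b = x\<close>.\<close>

lemma Omega_deg_small: "Omega_deg 1 = {}" "Omega_deg 2 = {}" "Omega_deg 3 = {(x \<cdot> x) \<cdot> x}"
proof -
  have deg_Gam: "deg s \<ge> 3" if "s \<in> Gam" for s
  proof (cases s)
    case (Mult a b)
    then have "deg a \<noteq> 1" using that deg_eq_1_iff[of a] by simp
    then show ?thesis using deg_pos[of a] deg_pos[of b] unfolding Mult deg.simps by linarith
  qed (use that in simp)
  have Omega_Gam: "Omega_deg n \<subseteq> Gam \<inter> trees n" for n
    by (auto simp: Omega_deg_def trees_def Omega_eq_indecomposables)
  show "Omega_deg 1 = {}" "Omega_deg 2 = {}"
    using Omega_Gam deg_Gam by (fastforce simp: trees_def)+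
  have sum_2: "deg a + deg b = Suc (Suc 0) \<longleftrightarrow> a = x \<and> b = x" for a b :: M
    using deg_pos[of a] deg_pos[of b] deg_eq_1_iff[of a] deg_eq_1_iff[of b] by linarith
  have "Gam \<inter> trees (Suc (Suc 0)) = {}" using deg_Gam by (fastforce simp: trees_def)
  then show "Omega_deg 3 = {(x \<cdot> x) \<cdot> x}"
    unfolding numeral_3_eq_3 Omega_deg_decomposition sum_2 by auto
qed

section \<open>The free generating set and its cardinalities\<close>

theorem proposition2p10:
  shows "(free_generating_set (\<cdot>) Gam Omega \<and>
      Some ` Omega =
        {xpow i v1 \<odot> xpow j v2 | i j v1 v2.
           v1 \<in> Some ` Gam \<union> {None} \<and> v2 \<in> Some ` Gam \<union> {None} \<and> i + j \<ge> 1 \<and>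
           (i \<le> 1 \<longrightarrow> v1 \<noteq> None) \<and> (j = 0 \<longrightarrow> v2 \<noteq> None)}) \<and>
    (Omega_deg 1 = {} \<and> Omega_deg 2 = {} \<and> Omega_deg 3 = {(x \<cdot> x) \<cdot> x} \<and>
      (\<forall>n\<ge>4. finite (Omega_deg n) \<and>
         real (card (Omega_deg n)) = 3 * (catalan (n - 1) - catalan (n - 2))))"
proof -
  have free: "free_generating_set (\<cdot>) Gam Omega"
    unfolding Omega_eq_indecomposables by (rule submagma_free_on_indecomposables[OF submagma_Gam])
  have "real (card (Omega_deg n)) = 3 * (catalan (n - 1) - catalan (n - 2))" if "n \<ge> 4" for n
  proof -
    define m where "m = n - 2"
    then have "n = Suc (Suc m)" "m \<ge> 2" using that by auto
    then show ?thesis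
      using card_Omega_deg[of m] card_trees_eq_catalan[of m] card_trees_eq_catalan[of "Suc m"] by simp
  qed
  then show ?thesis
    by (intro conjI allI impI free Omega_eq_xpow_products Omega_deg_small finite_Omega_deg) simp
qed

end
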